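(* Let $t$ be a table with $n\ge 2$ rows, and fix a predicate such that exactly $pn$ rows of $t$ satisfy it, where $p\in(0,1]$. Draw a sample of $k$ rows, $1\le k<n$, uniformly at random without replacement from $t$, let $\hat X$ be the number of sampled rows satisfying the predicate, and estimate the cardinality by $\mathrm{est}=\frac{n}{k}\hat X$, the true cardinality being $\mathrm{true}=pn$. Let $\sigma^2=p(1-p)$ (and $\sigma=\sqrt{p(1-p)}$), and define $$\rho=\begin{cases}1-\frac{k-1}{n} & \text{if } k\le n/2,\\ \big(1-\frac kn\big)\big(1+\frac1k\big) & \text{if } k>n/2,\end{cases}\qquad \zeta=\begin{cases}\frac43+\sqrt{\frac{k(k-1)}{n(n-k+1)}} & \text{if } k\le n/2,\\ \frac43+\sqrt{\frac{(n-k-1)(n-k)}{(k+1)n}} & \text{if } k>n/2.\end{cases}$$ Then for every $q\ge 1$, $$\mathbb{P}(\text{Q-error}\le q)\ \ge\ 1-\Omega-\Psi,$$ where $$\Omega=\min\Bigg(2\exp\Big(-\frac{k}{\zeta^2}\big(-\sqrt{2\zeta\rho\sigma^2(pq-p)+\rho^2\sigma^4}+(pq-p)\zeta+\sigma^2\rho\big)\Big),\ \exp\Big(-\frac{2k(pq-p)^2}{\rho}\Big)\Bigg),$$ $$\Psi=\min\Bigg(2\exp\Big(-\frac{k}{\zeta^2}\big(-\sqrt{2\zeta\rho\sigma^2(p-p/q)+\rho^2\sigma^4}+(p-p/q)\zeta+\sigma^2\rho\big)\Big),\ \exp\Big(-\frac{2k(p-p/q)^2}{\rho}\Big)\Bi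gg).$$
   Context: The Q-error of an estimate is $\max\big(\frac{\mathrm{true}'}{\mathrm{est}'},\frac{\mathrm{est}'}{\mathrm{true}'}\big)$, where $\mathrm{est}'=\max(\mathrm{est},1)$ and $\mathrm{true}'=\max(\mathrm{true},1)$ (to avoid division by zero). $\Omega$ bounds the probability of over-estimation ($\mathrm{est}\ge q\cdot\mathrm{true}$) and $\Psi$ the probability of under-estimation ($\mathrm{est}\le \mathrm{true}/q$). *)

theory Defs
  imports "HOL-Probability.Probability"
begin

definition qerror :: "real \<Rightarrow> real \<Rightarrow> real" where
  "qerror est tru = max (max tru 1 / max est 1) (max est 1 / max tru 1)"

definition sample_wo_repl :: "'a set \<Rightarrow> nat \<Rightarrow> 'a set pmf" where
  "sample_wo_repl T k = pmf_of_set {A. A \<subseteq> T \<and> card A = k}"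

definition rho_param :: "nat \<Rightarrow> nat \<Rightarrow> real" where
  "rho_param n k = (if real k \<le> real n / 2 then 1 - (real k - 1) / real n
                    else (1 - real k / real n) * (1 + 1 / real k))"

definition zeta_param :: "nat \<Rightarrow> nat \<Rightarrow> real" where
  "zeta_param n k = (if real k \<le> real n / 2
      then 4/3 + sqrt (real k * (real k - 1) / (real n * (real n - real k + 1)))
      else 4/3 + sqrt ((real n - real k - 1) * (real n - real k) / ((real k + 1) * real n)))"

definition tail_bound :: "nat \<Rightarrow> nat \<Rightarrow> real \<Rightarrow> real \<Rightarrow> real" where
  "tail_bound n k p d =
     (let \<rho> = rho_param n k; \<zeta> = zeta_param n k; \<sigma>2 = p * (1 - p) in
      min (2 * exp (- (real k / \<zeta>\<^sup>2) *
                 (- sqrt (2 * \<zeta> * \<rho> * \<sigma>2 * d + \<rho>\<^sup>2 * \<sigma>2\<^sup>2) + d * \<zeta> + \<sigma>2 * \<rho>)))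
          (exp (- (2 * real k * d\<^sup>2) / \<rho>)))"

definition Omega_bound :: "nat \<Rightarrow> nat \<Rightarrow> real \<Rightarrow> real \<Rightarrow> real" where
  "Omega_bound n k p q = tail_bound n k p (p * q - p)"

definition Psi_bound :: "nat \<Rightarrow> nat \<Rightarrow> real \<Rightarrow> real \<Rightarrow> real" where
  "Psi_bound n k p q = tail_bound n k p (p - p / q)"

end

theory Submission
  imports Defs
begin

text \<open>
  Let \<open>X\<close> be the number of sampled rows that satisfy the predicate. If the Q-error exceeds \<open>q\<close>, then
  \<open>X / k\<close> deviates from \<open>p\<close> by more than \<open>p q - p\<close> upwards or \<open>p - p / q\<close> downwards; a downward
  deviation of \<open>X\<close> is an upward one for the negated predicate. So it suffices to bound one upper tail,
  and both halves of the bound come from Markov's inequality for \<open>exp (l X)\<close>.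

  The sub-Gaussian half is Serfling's estimate of the moment generating function; for \<open>k > n / 2\<close> it
  is applied to the rows that are not sampled.

  For the Bernstein half, the probability generating function \<open>G\<close> of \<open>X\<close>, expanded in powers of
  \<open>x - 1\<close>, satisfies \<open>x G' x \<le> (\<mu> + V (x - 1)) G x\<close> coefficient by coefficient, where \<open>\<mu>\<close> and \<open>V\<close> are
  the exact mean and variance. Integrating gives Bennett's bound \<open>exp (V (exp l - 1 - l))\<close> for the
  centred count, and the stated rate follows since \<open>V \<le> k \<rho> \<sigma>\<^sup>2\<close> and \<open>\<zeta> \<ge> 4 / 3\<close>.
\<close>

subsection \<open>The hypergeometric generating function\<close>

abbreviation k_subsets :: "'a set \<Rightarrow> nat \<Rightarrow> 'a set set" where
  "k_subsets T k \<equiv> {A. A \<subseteq> T \<and> card A = k}"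

lemma finite_k_subsets: "finite T \<Longrightarrow> finite (k_subsets T k)"
  by (rule finite_subset[of _ "Pow T"]) auto

lemma card_k_supersets:
  assumes T: "finite T" and B: "B \<subseteq> T" and k: "card B \<le> k"
  shows "card {A \<in> k_subsets T k. B \<subseteq> A} = (card T - card B) choose (k - card B)"
proof -
  have fB: "finite B" using T B finite_subset by blast
  have "bij_betw (\<lambda>A. A - B) {A \<in> k_subsets T k. B \<subseteq> A} (k_subsets (T - B) (k - card B))"
  proof (rule bij_betwI[where g = "\<lambda>C. C \<union> B"])
    show "(\<lambda>A. A - B) \<in> {A \<in> k_subsets T k. B \<subseteq> A} \<rightarrow> k_subsets (T - B) (k - card B)"
      using fB by (auto simp: card_Diff_subset)
    show "(\<lambda>C. C \<union> B) \<in> k_subsets (T - B) (k - card B) \<rightarrow> {A \<in> k_subsets T k. B \<subseteq> A}"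
    proof
      fix C assume C: "C \<in> k_subsets (T - B) (k - card B)"
      hence "finite C" using T by (auto intro: finite_subset)
      hence "card (C \<union> B) = card C + card B"
        using C fB by (intro card_Un_disjoint) auto
      thus "C \<union> B \<in> {A \<in> k_subsets T k. B \<subseteq> A}" using C B k by auto
    qed
  qed auto
  hence "card {A \<in> k_subsets T k. B \<subseteq> A} = card (k_subsets (T - B) (k - card B))"
    by (rule bij_betw_same_card)
  also have "\<dots> = card (T - B) choose (k - card B)" using T by (intro n_subsets) auto
  finally show ?thesis using fB B by (simp add: card_Diff_subset)
qed

text \<open>Double counting of pairs \<open>(A, B)\<close> where \<open>B\<close> is an
  \<open>i\<close>-subset of \<open>A \<inter> S\<close>: grouped by \<open>A\<close> they give the
  binomials on the left, while each \<open>B\<close> lies in equally many samples.\<close>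

lemma sum_binomial_card_Int:
  assumes T: "finite T" and S: "S \<subseteq> T" and i: "i \<le> k"
  shows "(\<Sum>A\<in>k_subsets T k. card (A \<inter> S) choose i) =
    (card S choose i) * ((card T - i) choose (k - i))"
proof -
  have fS: "finite S" using T S finite_subset by blast
  have "(\<Sum>A\<in>k_subsets T k. card (A \<inter> S) choose i) =
        (\<Sum>A\<in>k_subsets T k. card {B \<in> k_subsets S i. B \<subseteq> A})"
  proof (rule sum.cong)
    fix A
    have "card (k_subsets (A \<inter> S) i) = card (A \<inter> S) choose i" using fS by (intro n_subsets) auto
    moreover have "k_subsets (A \<inter> S) i = {B \<in> k_subsets S i. B \<subseteq> A}" by auto
    ultimately show "card (A \<inter> S) choose i = card {B \<in> k_subsets S i. B \<subseteq> A}" by simp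
  qed auto
  also have "\<dots> = (\<Sum>B\<in>k_subsets S i. (card T - i) choose (k - i))"
  proof (rule sum_multicount_gen)
    show "\<forall>B\<in>k_subsets S i. card {A \<in> k_subsets T k. B \<subseteq> A} = (card T - i) choose (k - i)"
      using S i card_k_supersets[OF T, of _ k] by auto
  qed (use T fS finite_k_subsets in auto)
  also have "\<dots> = (card S choose i) * ((card T - i) choose (k - i))"
    by (simp add: n_subsets[OF fS])
  finally show ?thesis .
qed

text \<open>These are the binomial moments of the count: \<open>hyp_coeff n s k i\<close> is the expectation of
  \<open>X choose i\<close>, hence the coefficient of \<open>(x - 1)\<^sup>i\<close> in the generating function.\<close>

definition hyp_coeff :: "nat \<Rightarrow> nat \<Rightarrow> nat \<Rightarrow> nat \<Rightarrow> real" where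
  "hyp_coeff n s k i = real (s choose i) * real (k choose i) / real (n choose i)"

lemma hyp_coeff_nonneg: "hyp_coeff n s k i \<ge> 0"
  by (simp add: hyp_coeff_def)

lemma hyp_coeff_eq_0: "s < i \<or> k < i \<Longrightarrow> hyp_coeff n s k i = 0"
  by (auto simp: hyp_coeff_def)

text \<open>The ratio of consecutive coefficients, multiplied out. Truncated subtraction is
  harmless: once \<open>i\<close> reaches \<open>s\<close> or \<open>k\<close>, both sides are
  zero.\<close>

lemma hyp_coeff_Suc:
  assumes "i < n"
  shows "real (Suc i) * real (n - i) * hyp_coeff n s k (Suc i) =
    real (s - i) * real (k - i) * hyp_coeff n s k i"
proof -
  have *: "real (Suc i) * real (m choose Suc i) = real (m - i) * real (m choose i)" for m
    by (metis Suc_times_binomial_eq binomial_absorb_comp binomial_absorption mult.commute of_nat_mult)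
  have pos: "real (n choose i) > 0" "real (n choose Suc i) > 0" using assms by auto
  \<comment> \<open>The extra factor clears the denominator of \<open>hyp_coeff\<close>, so that the
    absorption identity \<open>*\<close> applies to each of the three binomials.\<close>
  have "real (Suc i) * real (n - i) * hyp_coeff n s k (Suc i) * (real (Suc i) * real (n choose Suc i)) =
     real (n - i) * (real (Suc i) * real (s choose Suc i)) * (real (Suc i) * real (k choose Suc i))"
    using pos by (simp add: hyp_coeff_def)
  also have "\<dots> = real (n - i) * (real (s - i) * real (s choose i)) * (real (k - i) * real (k choose i))"
    by (simp only: *)
  also have "\<dots> = real (s - i) * real (k - i) * hyp_coeff n s k i * (real (n - i) * real (n choose i))"
    using pos by (simp add: hyp_coeff_def)
  finally show ?thesis using pos by (simp add: *[of n, symmetric] del: of_nat_Suc)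
qed

text \<open>Expanding each power binomially and exchanging the sums leaves the binomial moments as
  coefficients. At \<open>y = exp l - 1\<close> this becomes the moment generating function.\<close>

lemma sum_power_card_Int:
  fixes y :: real
  assumes T: "finite T" and S: "S \<subseteq> T" and k: "k \<le> card T"
  shows "(\<Sum>A\<in>k_subsets T k. (1 + y) ^ card (A \<inter> S)) =
    real (card T choose k) * (\<Sum>i\<le>k. hyp_coeff (card T) (card S) k i * y ^ i)"
proof -
  have "(\<Sum>A\<in>k_subsets T k. (1 + y) ^ card (A \<inter> S)) =
        (\<Sum>A\<in>k_subsets T k. \<Sum>i\<le>k. real (card (A \<inter> S) choose i) * y ^ i)"
  proof (rule sum.cong)
    fix A assume A: "A \<in> k_subsets T k"
    hence "finite A" using T finite_subset by blast
    hence le: "card (A \<inter> S) \<le> k" using A by (auto intro: card_mono)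
    have "(1 + y) ^ card (A \<inter> S) = (\<Sum>i\<le>card (A \<inter> S). real (card (A \<inter> S) choose i) * y ^ i)"
      using binomial_ring[of y 1 "card (A \<inter> S)"] by (simp add: add.commute)
    also have "\<dots> = (\<Sum>i\<le>k. real (card (A \<inter> S) choose i) * y ^ i)"
      using le by (intro sum.mono_neutral_left) auto
    finally show "(1 + y) ^ card (A \<inter> S) = (\<Sum>i\<le>k. real (card (A \<inter> S) choose i) * y ^ i)" .
  qed auto
  also have "\<dots> = (\<Sum>i\<le>k. real (\<Sum>A\<in>k_subsets T k. card (A \<inter> S) choose i) * y ^ i)"
    by (subst sum.swap) (simp add: sum_distrib_right)
  also have "\<dots> = (\<Sum>i\<le>k. real (card T choose k) * (hyp_coeff (card T) (card S) k i * y ^ i))"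
  proof (rule sum.cong)
    fix i assume "i \<in> {..k}"
    hence i: "i \<le> k" by simp
    have "(card T choose k) * (k choose i) = (card T choose i) * ((card T - i) choose (k - i))"
      using i k by (rule choose_mult)
    hence "real (card T choose k) * real (k choose i) =
        real (card T choose i) * real ((card T - i) choose (k - i))"
      by (metis of_nat_mult)
    moreover have "real (card T choose i) > 0" using i k by simp
    ultimately have "real ((card T - i) choose (k - i)) =
        real (card T choose k) * real (k choose i) / real (card T choose i)"
      by (simp add: field_simps)
    thus "real (\<Sum>A\<in>k_subsets T k. card (A \<inter> S) choose i) * y ^ i =
        real (card T choose k) * (hyp_coeff (card T) (card S) k i * y ^ i)"
      using sum_binomial_card_Int[OF T S i] by (simp add: hyp_coeff_def)
  qed auto
  finally show ?thesis by (simp add: sum_distrib_left)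
qed

section \<open>Bennett's bound from a differential inequality\<close>

text \<open>Since \<open>y \<ge> 0\<close>, comparing coefficients suffices. In
  \<open>(1 + y) G' - \<mu> G\<close> the constant coefficient vanishes because \<open>\<mu>\<close>
  is the mean, and this frees the factor \<open>y\<close> that accompanies \<open>V\<close>.\<close>

lemma hyp_pgf_deriv_le:
  fixes y :: real
  assumes sn: "s \<le> n" and kn: "k < n" and y: "y \<ge> 0"
  defines "V \<equiv> real s * real k * (real n - real s) * (real n - real k) / ((real n)\<^sup>2 * (real n - 1))"
  shows "(1 + y) * (\<Sum>i\<le>k. hyp_coeff n s k i * (real i * y ^ (i - 1))) \<le>
    (real s * real k / real n + V * y) * (\<Sum>i\<le>k. hyp_coeff n s k i * y ^ i)"
proof -
  define g where "g = hyp_coeff n s k"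
  define c where "c = (real n - real s) * (real n - real k) / real n"
  define \<mu> where "\<mu> = real s * real k / real n"
  have n0: "real n > 0" using kn by simp
  \<comment> \<open>With real subtraction the numerator need not vanish for \<open>i > s\<close>,
    but then \<open>g i\<close> does.\<close>
  have step: "real (Suc i) * g (Suc i) = (real s - real i) * (real k - real i) / (real n - real i) * g i"
    if "i \<le> k" for i
  proof -
    have "real (s - i) * real (k - i) * g i = (real s - real i) * (real k - real i) * g i"
      using that by (cases "i \<le> s") (auto simp: g_def of_nat_diff hyp_coeff_eq_0)
    thus ?thesis using hyp_coeff_Suc[of i n s k] that kn
      by (simp add: g_def of_nat_diff field_simps del: of_nat_Suc)
  qed
  have excess: "(real s - real i) * (real k - real i) / (real n - real i) + real i - \<mu> =
      real i * c / (real n - real i)" if "i \<le> k" for i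
  proof -
    have "real n - real i > 0" using that kn by simp
    thus ?thesis using n0 unfolding c_def \<mu>_def by (simp add: field_simps)
  qed
  \<comment> \<open>By \<open>step\<close>, the quotient of the left side by \<open>g i\<close> is
    \<open>c\<close> times \<open>(s - i) / (n - i)\<close> times
    \<open>(k - i) / (n - 1 - i)\<close>. Both fractions decrease in \<open>i\<close>, and at
    \<open>i = 0\<close> the product is exactly \<open>V\<close>.\<close>
  have bound: "real (Suc i) * g (Suc i) * c / (real n - real (Suc i)) \<le> V * g i" if "i < k" for i
  proof (cases "i \<le> s")
    case False
    thus ?thesis by (simp add: g_def hyp_coeff_eq_0)
  next
    case True
    have gi: "g i \<ge> 0" by (simp add: g_def hyp_coeff_nonneg)
    have p: "real n - real i > 0" "real n - real (Suc i) > 0" "real n - 1 > 0" using that kn by auto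
    have c0: "c \<ge> 0" using sn kn by (auto simp: c_def)
    have "real i * (real n - real s) \<ge> 0" using sn by simp
    hence a: "(real s - real i) / (real n - real i) \<le> real s / real n"
      using p n0 by (simp add: field_simps)
    have "real i * (real n - 1 - real k) \<ge> 0" using kn by (intro mult_nonneg_nonneg) linarith+
    hence b: "(real k - real i) / (real n - real (Suc i)) \<le> real k / (real n - 1)"
      using p by (simp add: field_simps)
    have "(real s - real i) / (real n - real i) * ((real k - real i) / (real n - real (Suc i))) \<le>
        real s / real n * (real k / (real n - 1))"
      using a b p that True by (intro mult_mono) auto
    hence "(real s - real i) / (real n - real i) * ((real k - real i) / (real n - real (Suc i))) * (c * g i) \<le>
        real s / real n * (real k / (real n - 1)) * (c * g i)"
      using c0 gi by (intro mult_right_mono) auto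
    moreover have "real s / real n * (real k / (real n - 1)) * (c * g i) = V * g i"
      using n0 p by (simp add: V_def c_def power2_eq_square mult_ac)
    moreover have "real (Suc i) * g (Suc i) * c / (real n - real (Suc i)) =
        (real s - real i) / (real n - real i) * ((real k - real i) / (real n - real (Suc i))) * (c * g i)"
      using step[of i] that by (simp del: of_nat_Suc)
    ultimately show ?thesis by simp
  qed
  have D: "(\<Sum>i\<le>k. g i * (real i * y ^ (i - 1))) = (\<Sum>i\<le>k. real (Suc i) * g (Suc i) * y ^ i)"
  proof -
    have "g (Suc k) = 0" by (simp add: g_def hyp_coeff_eq_0)
    hence "(\<Sum>i\<le>k. real (Suc i) * g (Suc i) * y ^ i) = (\<Sum>i<k. real (Suc i) * g (Suc i) * y ^ i)"
      by (simp add: lessThan_Suc_atMost[symmetric])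
    also have "\<dots> = (\<Sum>i<Suc k. g i * (real i * y ^ (i - 1)))"
      by (subst sum.lessThan_Suc_shift) (simp add: algebra_simps)
    finally show ?thesis by (simp add: lessThan_Suc_atMost)
  qed
  have yD: "y * (\<Sum>i\<le>k. g i * (real i * y ^ (i - 1))) = (\<Sum>i\<le>k. real i * g i * y ^ i)"
    unfolding sum_distrib_left
  proof (rule sum.cong)
    fix i show "y * (g i * (real i * y ^ (i - 1))) = real i * g i * y ^ i" by (cases i) auto
  qed auto
  have "(1 + y) * (\<Sum>i\<le>k. g i * (real i * y ^ (i - 1))) - \<mu> * (\<Sum>i\<le>k. g i * y ^ i) =
      (\<Sum>i\<le>k. (real (Suc i) * g (Suc i) + real i * g i - \<mu> * g i) * y ^ i)"
  proof -
    have "(1 + y) * (\<Sum>i\<le>k. g i * (real i * y ^ (i - 1))) =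
        (\<Sum>i\<le>k. real (Suc i) * g (Suc i) * y ^ i) + (\<Sum>i\<le>k. real i * g i * y ^ i)"
      unfolding yD[symmetric] D[symmetric] by (simp only: distrib_right mult_1_left)
    thus ?thesis by (simp only: sum_distrib_left sum.distrib sum_subtractf left_diff_distrib
        distrib_right mult.assoc)
  qed
  also have "\<dots> = (\<Sum>i\<le>k. real i * g i * c / (real n - real i) * y ^ i)"
  proof (rule sum.cong)
    fix i assume "i \<in> {..k}"
    hence i: "i \<le> k" by simp
    have "real (Suc i) * g (Suc i) + real i * g i - \<mu> * g i =
       ((real s - real i) * (real k - real i) / (real n - real i) + real i - \<mu>) * g i"
      by (simp only: step[OF i] algebra_simps)
    thus "(real (Suc i) * g (Suc i) + real i * g i - \<mu> * g i) * y ^ i =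
        real i * g i * c / (real n - real i) * y ^ i"
      by (simp only: excess[OF i]) simp
  qed auto
  also have "\<dots> = (\<Sum>i<k. real (Suc i) * g (Suc i) * c / (real n - real (Suc i)) * y ^ Suc i)"
    unfolding lessThan_Suc_atMost[symmetric] by (subst sum.lessThan_Suc_shift) simp
  also have "\<dots> \<le> (\<Sum>i<k. V * g i * y ^ Suc i)"
    using bound y by (intro sum_mono mult_right_mono) auto
  also have "\<dots> \<le> (\<Sum>i\<le>k. V * g i * y ^ Suc i)"
  proof (intro sum_mono2)
    fix i
    have "V \<ge> 0" using sn kn by (auto simp: V_def)
    thus "0 \<le> V * g i * y ^ Suc i" using y by (simp add: g_def hyp_coeff_nonneg)
  qed auto
  also have "\<dots> = V * y * (\<Sum>i\<le>k. g i * y ^ i)"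
    by (simp add: sum_distrib_left algebra_simps)
  finally show ?thesis by (simp add: g_def \<mu>_def algebra_simps)
qed

text \<open>Under \<open>x = exp l\<close> the differential inequality bounds the logarithmic
  derivative in \<open>l\<close> by \<open>\<mu> + V (exp l - 1)\<close>, whose integral from 0 is
  the exponent on the right.\<close>

lemma hyp_bennett_mgf:
  assumes T: "finite T" and S: "S \<subseteq> T" and k: "k < card T" and l: "l \<ge> (0::real)"
  defines "n \<equiv> real (card T)" and "s \<equiv> real (card S)"
  defines "V \<equiv> s * real k * (n - s) * (n - real k) / (n\<^sup>2 * (n - 1))"
  shows "(\<Sum>A\<in>k_subsets T k. exp (l * real (card (A \<inter> S)))) \<le>
    real (card T choose k) * exp (s * real k / n * l + V * (exp l - 1 - l))"
proof -
  define F where "F = (\<lambda>y::real. \<Sum>i\<le>k. hyp_coeff (card T) (card S) k i * y ^ i)"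
  define F' where "F' = (\<lambda>y::real. \<Sum>i\<le>k. hyp_coeff (card T) (card S) k i * (real i * y ^ (i - 1)))"
  define L where "L = (\<lambda>l. s * real k / n * l + V * (exp l - 1 - l))"
  \<comment> \<open>Multiplying by the integrating factor \<open>exp (- L l)\<close> turns the
    inequality into monotonicity of \<open>H\<close>, without logarithms.\<close>
  define H where "H = (\<lambda>l. F (exp l - 1) * exp (- L l))"
  have sT: "card S \<le> card T" using T S by (rule card_mono)
  have F0: "F 0 = 1"
  proof -
    have "F 0 = (\<Sum>i\<le>k. if i = 0 then hyp_coeff (card T) (card S) k i else 0)"
      unfolding F_def by (intro sum.cong) auto
    thus ?thesis by (simp add: hyp_coeff_def)
  qed
  have L0: "L 0 = 0" by (simp add: L_def)
  have dF: "(F has_real_derivative F' y) (at y)" for y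
    unfolding F_def F'_def by (auto intro!: derivative_eq_intros sum.cong simp: mult_ac)
  have dH: "(H has_real_derivative
      (exp x * F' (exp x - 1) - (s * real k / n + V * (exp x - 1)) * F (exp x - 1)) *
      exp (- L x)) (at x)" for x
    unfolding H_def L_def
    by (rule derivative_eq_intros DERIV_chain2[OF dF] refl)+ (simp add: algebra_simps)
  have "H l \<le> H 0"
  proof (rule DERIV_nonpos_imp_nonincreasing[OF l])
    fix x :: real assume x: "0 \<le> x" "x \<le> l"
    have "exp x * F' (exp x - 1) \<le> (s * real k / n + V * (exp x - 1)) * F (exp x - 1)"
      using hyp_pgf_deriv_le[OF sT k, of "exp x - 1"] x
      unfolding F_def F'_def V_def n_def s_def by simp
    thus "\<exists>d. (H has_real_derivative d) (at x) \<and> d \<le> 0"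
      using dH[of x] by (blast intro: mult_nonpos_nonneg exp_ge_zero diff_le_0_iff_le[THEN iffD2])
  qed
  hence "F (exp l - 1) \<le> exp (L l)"
    using L0 by (simp add: H_def F0 exp_minus field_simps)
  moreover have "(\<Sum>A\<in>k_subsets T k. exp (l * real (card (A \<inter> S)))) =
      real (card T choose k) * F (exp l - 1)"
    using sum_power_card_Int[OF T S, of k "exp l - 1"] k
    by (simp add: F_def exp_of_nat_mult[symmetric] mult.commute)
  ultimately show ?thesis by (simp add: mult_left_mono L_def)
qed

subsection \<open>Serfling's bound\<close>

text \<open>Each set of size \<open>k + 1\<close> arises \<open>k + 1\<close> times as a
  \<open>k\<close>-set plus a last drawn element. This replaces conditioning on the first
  \<open>k\<close> draws.\<close>

lemma sum_k_subsets_Suc: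
  fixes f :: "'a set \<Rightarrow> real"
  assumes T: "finite T"
  shows "real (Suc k) * (\<Sum>A\<in>k_subsets T (Suc k). f A) =
    (\<Sum>B\<in>k_subsets T k. \<Sum>x\<in>T - B. f (insert x B))"
proof -
  have fin: "finite A" if "A \<subseteq> T" for A using T that finite_subset by blast
  have "real (Suc k) * (\<Sum>A\<in>k_subsets T (Suc k). f A) = (\<Sum>A\<in>k_subsets T (Suc k). \<Sum>x\<in>A. f A)"
    by (simp add: sum_distrib_left)
  also have "\<dots> = (\<Sum>(A, x)\<in>Sigma (k_subsets T (Suc k)) (\<lambda>A. A). f A)"
    using T fin by (subst sum.Sigma) (auto simp: finite_k_subsets)
  also have "\<dots> = (\<Sum>(B, x)\<in>Sigma (k_subsets T k) (\<lambda>B. T - B). f (insert x B))"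
    by (rule sum.reindex_bij_witness[where i = "\<lambda>(B, x). (insert x B, x)"
          and j = "\<lambda>(A, x). (A - {x}, x)"])
       (use fin in \<open>auto simp: insert_absorb card_insert_if\<close>)
  also have "\<dots> = (\<Sum>B\<in>k_subsets T k. \<Sum>x\<in>T - B. f (insert x B))"
    using T by (subst sum.Sigma) (auto simp: finite_k_subsets)
  finally show ?thesis .
qed

text \<open>Hoeffding's lemma for a Bernoulli variable, exponentiated from its logarithmic
  form.\<close>

lemma bernoulli_mgf_le:
  fixes l p :: real
  assumes "l \<ge> 0" "0 \<le> p"
  shows "p * exp l + (1 - p) \<le> exp (l * p + l\<^sup>2 / 8)"
proof -
  have "1 + p * (exp l - 1) > 0" using assms by (intro add_pos_nonneg mult_nonneg_nonneg) auto
  moreover have "ln (1 + p * (exp l - 1)) \<le> l * p + l\<^sup>2 / 8"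
    using Hoeffdings_lemma_aux[OF assms] by simp
  ultimately have "1 + p * (exp l - 1) \<le> exp (l * p + l\<^sup>2 / 8)"
    by (metis exp_le_cancel_iff exp_ln)
  thus ?thesis by (simp add: algebra_simps)
qed

text \<open>Serfling's argument: given the first \<open>k\<close> draws, the next one is Bernoulli, and its conditional
  mean contracts the centred count by the factor \<open>1 - 1 / (n - k)\<close>.\<close>

lemma serfling_mgf:
  assumes T: "finite T" and S: "S \<subseteq> T" and k: "k < card T" and l: "l \<ge> (0::real)"
  defines "n \<equiv> real (card T)" and "s \<equiv> real (card S)"
  shows "(\<Sum>A\<in>k_subsets T k. exp (l * real (card (A \<inter> S)))) \<le>
    real (card T choose k) * exp (l * (real k * s / n) + l\<^sup>2 * (real k * (n - real k + 1) / n) / 8)"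
  using k l
proof (induction k arbitrary: l)
  case 0
  have "k_subsets T 0 = {{}}" using T by (auto dest: finite_subset)
  thus ?case by simp
next
  case (Suc k)
  define m where "m = n - real k"
  define c where "c = (\<lambda>B. real (card (B \<inter> S)))"
  have fS: "finite S" using T S finite_subset by blast
  have m1: "m > 1" using Suc.prems by (simp add: m_def n_def)
  have n0: "n > 0" using Suc.prems by (simp add: n_def)
  \<comment> \<open>Of the \<open>m\<close> rows outside \<open>B\<close>, \<open>s - c B\<close>
    lie in \<open>S\<close>. The Bernoulli bound with this proportion contributes
    \<open>- l * c B / m\<close>, which merges with \<open>l * c B\<close>.\<close>
  have inner: "(\<Sum>x\<in>T - B. exp (l * c (insert x B))) \<le>
      m * exp (l\<^sup>2 / 8 + l * (s / m)) * exp (l * (1 - 1 / m) * c B)" if B: "B \<in> k_subsets T k" for B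
  proof -
    have fB: "finite B" using B T finite_subset by blast
    have cS: "real (card (S - B)) = s - c B"
      using fS by (simp add: card_Diff_subset_Int Int_commute s_def c_def of_nat_diff card_mono)
    have cTB: "real (card (T - B)) = m"
      using B fB Suc.prems T by (simp add: card_Diff_subset m_def n_def of_nat_diff)
    have cTS: "real (card (T - B - S)) = m - (s - c B)"
    proof -
      have "card (T - B) = card (S - B) + card (T - B - S)"
        using T fS S by (subst card_Un_disjoint[symmetric]) (auto intro!: arg_cong[where f = card])
      thus ?thesis using cS cTB by simp
    qed
    have q0: "0 \<le> (s - c B) / m" using m1 cS by (metis divide_nonneg_nonneg of_nat_0_le_iff less_imp_le order.trans zero_le_one)
    have "(\<Sum>x\<in>T - B. exp (l * c (insert x B))) =
        (\<Sum>x\<in>S - B. exp (l * c (insert x B))) + (\<Sum>x\<in>T - B - S. exp (l * c (insert x B)))"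
      using T S fS by (subst sum.union_disjoint[symmetric]) (auto intro!: sum.cong)
    also have "(\<Sum>x\<in>S - B. exp (l * c (insert x B))) = (\<Sum>x\<in>S - B. exp (l * (c B + 1)))"
      using fB by (intro sum.cong) (auto simp: c_def)
    also have "(\<Sum>x\<in>T - B - S. exp (l * c (insert x B))) = (\<Sum>x\<in>T - B - S. exp (l * c B))"
      by (intro sum.cong) (auto simp: c_def)
    also have "(\<Sum>x\<in>S - B. exp (l * (c B + 1))) + (\<Sum>x\<in>T - B - S. exp (l * c B)) =
        m * exp (l * c B) * ((s - c B) / m * exp l + (1 - (s - c B) / m))"
      using m1 by (simp add: cS cTS exp_add distrib_left field_simps)
    also have "m * exp (l * c B) * ((s - c B) / m * exp l + (1 - (s - c B) / m)) \<le>
        m * exp (l * c B) * exp (l * ((s - c B) / m) + l\<^sup>2 / 8)"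
      using m1 q0 Suc.prems by (intro mult_left_mono bernoulli_mgf_le) auto
    also have "m * exp (l * c B) * exp (l * ((s - c B) / m) + l\<^sup>2 / 8) =
        m * exp (l\<^sup>2 / 8 + l * (s / m)) * exp (l * (1 - 1 / m) * c B)"
      using m1 by (simp add: exp_add[symmetric] field_simps)
    finally show ?thesis .
  qed
  have "real (Suc k) * (\<Sum>A\<in>k_subsets T (Suc k). exp (l * c A)) \<le>
      (\<Sum>B\<in>k_subsets T k. m * exp (l\<^sup>2 / 8 + l * (s / m)) * exp (l * (1 - 1 / m) * c B))"
    unfolding sum_k_subsets_Suc[OF T] by (intro sum_mono inner)
  also have "\<dots> = m * exp (l\<^sup>2 / 8 + l * (s / m)) * (\<Sum>B\<in>k_subsets T k. exp (l * (1 - 1 / m) * c B))"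
    by (simp add: sum_distrib_left)
  \<comment> \<open>The induction hypothesis is taken at the contracted parameter
    \<open>l * (1 - 1 / m)\<close>, which is why \<open>l\<close> is generalised.\<close>
  also have "\<dots> \<le> m * exp (l\<^sup>2 / 8 + l * (s / m)) * (real (card T choose k) *
      exp (l * (1 - 1 / m) * (real k * s / n) + (l * (1 - 1 / m))\<^sup>2 * (real k * (m + 1) / n) / 8))"
    using Suc.IH[of "l * (1 - 1 / m)"] Suc.prems m1
    by (intro mult_left_mono) (auto simp: c_def m_def)
  also have "\<dots> = m * real (card T choose k) * exp (l * (real (Suc k) * s / n) +
      l\<^sup>2 * (1 + (1 - 1 / m)\<^sup>2 * (real k * (m + 1) / n)) / 8)"
  proof -
    have "s / m + (1 - 1 / m) * (real k * s / n) = real (Suc k) * s / n"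
    proof -
      have "s / m + (1 - 1 / m) * (real k * s / n) = s / m * (1 - real k / n) + real k * s / n"
        by (simp add: algebra_simps diff_divide_distrib)
      also have "1 - real k / n = m / n" using n0 by (simp add: m_def field_simps)
      finally show ?thesis using m1 by (simp add: add_divide_distrib distrib_right)
    qed
    hence "l * (real (Suc k) * s / n) = l * (s / m) + l * (1 - 1 / m) * (real k * s / n)"
      by (metis distrib_left mult.assoc)
    hence "l\<^sup>2 / 8 + l * (s / m) + (l * (1 - 1 / m) * (real k * s / n) +
        (l * (1 - 1 / m))\<^sup>2 * (real k * (m + 1) / n) / 8) =
      l * (real (Suc k) * s / n) + l\<^sup>2 * (1 + (1 - 1 / m)\<^sup>2 * (real k * (m + 1) / n)) / 8"
      by (simp add: power_mult_distrib distrib_left add_divide_distrib mult.assoc)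
    thus ?thesis by (simp add: exp_add[symmetric])
  qed
  also have "\<dots> \<le> m * real (card T choose k) * exp (l * (real (Suc k) * s / n) +
      l\<^sup>2 * (real (Suc k) * (n - real (Suc k) + 1) / n) / 8)"
  proof -
    \<comment> \<open>The left side is \<open>(m - 1) (m^2 - 1)\<close>. The variance factor for
      \<open>k + 1\<close> draws is thus at most \<open>1 + (m - 1) k / n\<close>, which equals
      \<open>(k + 1) (n - k) / n\<close>.\<close>
    have "(m - 1)\<^sup>2 * (m + 1) \<le> (m - 1) * m\<^sup>2"
      using m1 by (simp add: power2_eq_square algebra_simps)
    hence "(1 - 1 / m)\<^sup>2 * (m + 1) \<le> m - 1"
      using m1 by (simp add: power2_eq_square field_simps)
    hence "(1 - 1 / m)\<^sup>2 * (m + 1) * (real k / n) \<le> (m - 1) * (real k / n)"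
      using n0 by (intro mult_right_mono) auto
    moreover have "1 + (m - 1) * (real k / n) = real (Suc k) * (n - real (Suc k) + 1) / n"
      using n0 by (simp add: m_def field_simps)
    ultimately have "1 + (1 - 1 / m)\<^sup>2 * (real k * (m + 1) / n) \<le>
        real (Suc k) * (n - real (Suc k) + 1) / n"
      by (simp add: mult_ac)
    thus ?thesis using m1
      by (intro mult_left_mono[of "exp _"] iffD2[OF exp_le_cancel_iff] add_left_mono divide_right_mono
          mult_left_mono[of _ _ "l\<^sup>2"]) auto
  qed
  also have "m * real (card T choose k) = real (Suc k) * real (card T choose Suc k)"
  proof -
    have "Suc k * (card T choose Suc k) = (card T - k) * (card T choose k)"
      by (metis Suc_times_binomial_eq binomial_absorb_comp binomial_absorption mult.commute)
    moreover have "m = real (card T - k)" using Suc.prems by (simp add: m_def n_def of_nat_diff)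
    ultimately show ?thesis by (metis of_nat_mult)
  qed
  finally show ?case by (simp add: c_def mult.assoc del: of_nat_Suc)
qed

section \<open>Complementary samples and the factor rho\<close>

lemma sum_k_subsets_compl:
  assumes T: "finite T" and k: "k \<le> card T"
  shows "(\<Sum>A\<in>k_subsets T k. f A) = (\<Sum>A\<in>k_subsets T (card T - k). f (T - A))"
proof -
  have "card (T - A) = card T - card A" if "A \<subseteq> T" for A
    using that T finite_subset[OF that T] by (simp add: card_Diff_subset)
  thus ?thesis
    by (intro sum.reindex_bij_witness[where i = "\<lambda>A. T - A" and j = "\<lambda>A. T - A"])
       (use k in \<open>auto simp: double_diff\<close>)
qed

text \<open>Complementing the sample flips the sign of the deviation and negating the predicate
  flips it back, so an upper tail stays an upper tail.\<close>

lemma centred_card_compl: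
  assumes T: "finite T" and S: "S \<subseteq> T" "real (card S) = p * real (card T)"
    and A: "A \<subseteq> T"
  shows "real (card ((T - A) \<inter> S)) - real (card (T - A)) * p =
    real (card (A \<inter> (T - S))) - real (card A) * (1 - p)"
proof -
  have fin: "finite S" "finite A" using T S A finite_subset by blast+
  have "card A = card (A \<inter> S) + card (A \<inter> (T - S))"
    using A fin by (subst card_Un_disjoint[symmetric]) (auto intro!: arg_cong[where f = card])
  moreover have "card S = card (A \<inter> S) + card ((T - A) \<inter> S)"
    using S fin by (subst card_Un_disjoint[symmetric]) (auto intro!: arg_cong[where f = card])
  moreover have "real (card (T - A)) = real (card T) - real (card A)"
    using T A fin by (simp add: card_Diff_subset of_nat_diff card_mono)
  moreover from this have "p * real (card T) = p * real (card (T - A)) + p * real (card A)"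
    by (simp flip: distrib_left)
  ultimately show ?thesis using S(2) by (simp add: algebra_simps)
qed

lemma centred_serfling_mgf:
  assumes T: "finite T" and S: "S \<subseteq> T" "real (card S) = p * real (card T)"
    and k: "k < card T" and l: "l \<ge> 0"
  shows "(\<Sum>A\<in>k_subsets T k. exp (l * (real (card (A \<inter> S)) - real k * p))) \<le>
    real (card T choose k) * exp (l\<^sup>2 * (real k * (real (card T) - real k + 1) / real (card T)) / 8)"
proof -
  have "(\<Sum>A\<in>k_subsets T k. exp (l * (real (card (A \<inter> S)) - real k * p))) =
      exp (- (l * real k * p)) * (\<Sum>A\<in>k_subsets T k. exp (l * real (card (A \<inter> S))))"
    by (simp add: sum_distrib_left exp_add[symmetric] algebra_simps)
  also have "\<dots> \<le> exp (- (l * real k * p)) * (real (card T choose k) *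
      exp (l * (real k * real (card S) / real (card T)) +
        l\<^sup>2 * (real k * (real (card T) - real k + 1) / real (card T)) / 8))"
    using serfling_mgf[OF T S(1) k l] by (intro mult_left_mono) auto
  also have "real k * real (card S) / real (card T) = real k * p"
    using k S(2) by auto
  also have "exp (- (l * real k * p)) * (real (card T choose k) *
      exp (l * (real k * p) + l\<^sup>2 * (real k * (real (card T) - real k + 1) / real (card T)) / 8)) =
    real (card T choose k) * exp (l\<^sup>2 * (real k * (real (card T) - real k + 1) / real (card T)) / 8)"
    by (simp add: exp_add exp_minus field_simps)
  finally show ?thesis .
qed

text \<open>The two cases of \<open>rho_param\<close> are Serfling's factor for samples of size
  \<open>k\<close> and \<open>n - k\<close>: \<open>k * rho\<close> is
  \<open>k (n - k + 1) / n\<close> or \<open>(n - k) (k + 1) / n\<close>.\<close>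

lemma rho_mgf:
  assumes T: "finite T" and S: "S \<subseteq> T" "real (card S) = p * real (card T)"
    and k: "0 < k" "k < card T" and l: "l \<ge> 0"
  shows "(\<Sum>A\<in>k_subsets T k. exp (l * (real (card (A \<inter> S)) - real k * p))) \<le>
    real (card T choose k) * exp (l\<^sup>2 * (real k * rho_param (card T) k) / 8)"
proof (cases "real k \<le> real (card T) / 2")
  case True
  have "real k * (real (card T) - real k + 1) / real (card T) = real k * rho_param (card T) k"
    using True k by (simp add: rho_param_def field_simps)
  thus ?thesis using centred_serfling_mgf[OF T S k(2) l] by simp
next
  case False
  let ?k' = "card T - k"
  have fS: "finite S" using T S finite_subset by blast
  have S': "real (card (T - S)) = (1 - p) * real (card T)"
    using T S fS by (simp add: card_Diff_subset of_nat_diff card_mono algebra_simps)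
  have "(\<Sum>A\<in>k_subsets T k. exp (l * (real (card (A \<inter> S)) - real k * p))) =
      (\<Sum>A\<in>k_subsets T ?k'. exp (l * (real (card ((T - A) \<inter> S)) - real k * p)))"
    using k by (intro sum_k_subsets_compl T) auto
  also have "\<dots> = (\<Sum>A\<in>k_subsets T ?k'. exp (l * (real (card (A \<inter> (T - S))) - real ?k' * (1 - p))))"
  proof (rule sum.cong)
    fix A assume A: "A \<in> k_subsets T ?k'"
    have "finite A" using A T finite_subset by blast
    hence "card (T - A) = k" using A T k by (simp add: card_Diff_subset)
    thus "exp (l * (real (card ((T - A) \<inter> S)) - real k * p)) =
        exp (l * (real (card (A \<inter> (T - S))) - real ?k' * (1 - p)))"
      using centred_card_compl[OF T S, of A] A by simp
  qed auto
  also have "\<dots> \<le> real (card T choose ?k') *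
      exp (l\<^sup>2 * (real ?k' * (real (card T) - real ?k' + 1) / real (card T)) / 8)"
    using k S' by (intro centred_serfling_mgf T l) auto
  also have "real ?k' * (real (card T) - real ?k' + 1) / real (card T) = real k * rho_param (card T) k"
    using False k by (simp add: rho_param_def of_nat_diff field_simps)
  also have "card T choose ?k' = card T choose k"
    using k by (intro binomial_symmetric[symmetric]) auto
  finally show ?thesis .
qed

section \<open>Bounding the exact variance through rho\<close>

lemma rho_param_pos:
  assumes "0 < k" "k < n"
  shows "rho_param n k > 0"
proof -
  have "real k \<le> real n / 2 \<Longrightarrow> (real k - 1) / real n < 1" using assms by (simp add: field_simps)
  thus ?thesis using assms by (auto simp: rho_param_def intro!: mult_pos_pos add_pos_nonneg)
qed

text \<open>The left side is the finite population correction: the exact variance is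
  \<open>k p (1 - p)\<close> times it.\<close>

lemma finite_population_factor_le_rho_param:
  assumes "0 < k" "k < n"
  shows "(real n - real k) / (real n - 1) \<le> rho_param n k"
proof -
  have n: "real n - 1 > 0" using assms by simp
  show ?thesis
  proof (cases "real k \<le> real n / 2")
    case True
    thus ?thesis using assms n by (simp add: rho_param_def field_simps)
  next
    case False
    \<comment> \<open>The second factors differ by \<open>n - k - 1\<close>, which is nonnegative
      because \<open>k < n\<close>.\<close>
    have "(real n - real k) * (real k * real n) \<le> (real n - real k) * ((real k + 1) * (real n - 1))"
      using assms by (intro mult_left_mono) (auto simp: algebra_simps)
    hence "(real n - real k) / (real n - 1) \<le> (real n - real k) * (real k + 1) / (real k * real n)"
      using assms n by (simp add: field_simps)
    also have "\<dots> = rho_param n k" using False assms by (simp add: rho_param_def field_simps)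
    finally show ?thesis .
  qed
qed

lemma rho_bennett_mgf:
  assumes T: "finite T" and S: "S \<subseteq> T" "real (card S) = p * real (card T)"
    and k: "0 < k" "k < card T" and l: "l \<ge> 0"
  shows "(\<Sum>A\<in>k_subsets T k. exp (l * (real (card (A \<inter> S)) - real k * p))) \<le>
    real (card T choose k) * exp (real k * (p * (1 - p) * rho_param (card T) k) * (exp l - 1 - l))"
proof -
  define n where "n = real (card T)"
  define V where "V = real (card S) * real k * (n - real (card S)) * (n - real k) / (n\<^sup>2 * (n - 1))"
  have n: "n > 1" using k by (simp add: n_def)
  have "card S \<le> card T" using T S by (intro card_mono)
  hence "p * n \<le> 1 * n" using S by (simp add: n_def)
  hence p1: "p \<le> 1" using n by simp
  have "0 \<le> p * n" by (metis S(2) n_def of_nat_0_le_iff)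
  hence p0: "p \<ge> 0" using n by (simp add: zero_le_mult_iff)
  have "V = real k * (p * (1 - p)) * ((n - real k) / (n - 1))"
    using n S(2) by (simp add: V_def power2_eq_square divide_simps flip: n_def) (simp add: algebra_simps)
  also have "\<dots> \<le> real k * (p * (1 - p)) * rho_param (card T) k"
    using p0 p1 finite_population_factor_le_rho_param[OF k]
    by (intro mult_left_mono) (auto simp: n_def)
  finally have V: "V \<le> real k * (p * (1 - p) * rho_param (card T) k)" by (simp add: mult.assoc)
  have psi: "exp l - 1 - l \<ge> 0" using exp_ge_add_one_self[of l] by linarith
  have "(\<Sum>A\<in>k_subsets T k. exp (l * (real (card (A \<inter> S)) - real k * p))) =
      exp (- (l * real k * p)) * (\<Sum>A\<in>k_subsets T k. exp (l * real (card (A \<inter> S))))"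
    by (simp add: sum_distrib_left exp_add[symmetric] algebra_simps)
  also have "\<dots> \<le> exp (- (l * real k * p)) * (real (card T choose k) *
      exp (real (card S) * real k / n * l + V * (exp l - 1 - l)))"
    using hyp_bennett_mgf[OF T S(1) k(2) l] unfolding V_def n_def by (intro mult_left_mono) auto
  also have "real (card S) * real k / n = p * real k"
    using n S(2) by (simp add: n_def)
  also have "exp (- (l * real k * p)) * (real (card T choose k) *
      exp (p * real k * l + V * (exp l - 1 - l))) =
    real (card T choose k) * exp (V * (exp l - 1 - l))"
    by (simp add: mult.left_commute[of "exp _"] exp_add[symmetric])
  also have "\<dots> \<le> real (card T choose k) *
      exp (real k * (p * (1 - p) * rho_param (card T) k) * (exp l - 1 - l))"
    using V psi by (intro mult_left_mono) (auto intro: mult_right_mono)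
  finally show ?thesis .
qed

subsection \<open>Tail bounds\<close>

text \<open>Markov's inequality in counting form: \<open>exp (l * (X A - a))\<close> is at least 1
  on the counted sets.\<close>

lemma card_ge_le_sum_exp:
  fixes X :: "'a \<Rightarrow> real"
  assumes "finite \<A>" "l \<ge> 0"
  shows "real (card {A \<in> \<A>. a \<le> X A}) \<le> exp (- (l * a)) * (\<Sum>A\<in>\<A>. exp (l * X A))"
proof -
  have "real (card {A \<in> \<A>. a \<le> X A}) = (\<Sum>A\<in>{A \<in> \<A>. a \<le> X A}. 1)" by simp
  also have "\<dots> \<le> (\<Sum>A\<in>{A \<in> \<A>. a \<le> X A}. exp (l * (X A - a)))"
    using assms by (intro sum_mono) auto
  also have "\<dots> \<le> (\<Sum>A\<in>\<A>. exp (l * (X A - a)))"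
    using assms by (intro sum_mono2) auto
  also have "\<dots> = exp (- (l * a)) * (\<Sum>A\<in>\<A>. exp (l * X A))"
    by (simp add: sum_distrib_left exp_add[symmetric] algebra_simps)
  finally show ?thesis .
qed

lemma exp_minus_one_minus_le:
  fixes l :: real
  assumes "0 \<le> l" "l < 1"
  shows "exp l - 1 - l \<le> l\<^sup>2 / (2 * (1 - l))"
proof -
  \<comment> \<open>Cross-multiplying by \<open>1 - x\<close> gives a difference with the simple
    derivative \<open>x * (exp x - 1)\<close>.\<close>
  define h where "h = (\<lambda>x::real. x\<^sup>2 / 2 - (1 - x) * (exp x - 1 - x))"
  have "h 0 \<le> h l"
  proof (rule DERIV_nonneg_imp_nondecreasing[OF assms(1)])
    fix x :: real assume x: "0 \<le> x" "x \<le> l"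
    have "(h has_real_derivative x * (exp x - 1)) (at x)"
      unfolding h_def by (auto intro!: derivative_eq_intros simp: algebra_simps)
    thus "\<exists>d. (h has_real_derivative d) (at x) \<and> 0 \<le> d"
      using x by (intro exI[of _ "x * (exp x - 1)"]) auto
  qed
  thus ?thesis using assms by (simp add: h_def field_simps)
qed

text \<open>The left-hand side of the inequality is the root \<open>u\<close> of \<open>c u + sqrt (2 v u) = d\<close>, that is, the Legendre transform of
  the sub-gamma bound \<open>v l\<^sup>2 / (2 (1 - c l))\<close> at \<open>d\<close>.\<close>

lemma sub_gamma_exponent:
  fixes v c d :: real
  assumes v: "v \<ge> 0" and c: "c \<ge> 1" and d: "d \<ge> 0"
  shows "\<exists>l\<ge>0. (- sqrt (2 * c * v * d + v\<^sup>2) + d * c + v) / c\<^sup>2 \<le> l * d - v * (exp l - 1 - l)"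
proof (cases "v = 0")
  case True
  thus ?thesis using c by (intro exI[of _ "1 / c"]) (simp add: power2_eq_square)
next
  case False
  hence v0: "v > 0" using v by simp
  define w where "w = sqrt (2 * c * v * d + v\<^sup>2)"
  have w2: "w\<^sup>2 = 2 * c * v * d + v\<^sup>2" using v c d by (simp add: w_def)
  have wv: "w \<ge> v" unfolding w_def using v c d by (intro real_le_rsqrt) simp
  \<comment> \<open>The maximiser of \<open>l * d - v * l^2 / (2 * (1 - c * l))\<close>,
    characterised by \<open>1 - c * l = v / w\<close>.\<close>
  define l where "l = (w - v) / (c * w)"
  have w0: "w > 0" using wv v0 by simp
  have cl: "1 - c * l = v / w" using w0 c by (simp add: l_def field_simps)
  have l0: "l \<ge> 0" using wv w0 c by (simp add: l_def)
  have lc: "l \<le> c * l" using l0 c by (simp add: mult_le_cancel_right1)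
  have "c * l < 1" using cl v0 w0 by (smt (verit) divide_pos_pos)
  hence l1: "l < 1" using lc by simp
  have "exp l - 1 - l \<le> l\<^sup>2 / (2 * (1 - l))" using l0 l1 by (rule exp_minus_one_minus_le)
  \<comment> \<open>Here \<open>c \<ge> 1\<close> enters: the exponential function gives scale 1,
    which is relaxed to scale \<open>c\<close>.\<close>
  also have "\<dots> \<le> l\<^sup>2 / (2 * (1 - c * l))"
    using lc \<open>c * l < 1\<close> l1 by (intro divide_left_mono) auto
  finally have "v * (exp l - 1 - l) \<le> v * (l\<^sup>2 / (2 * (v / w)))"
    using v cl by (intro mult_left_mono) auto
  also have "\<dots> = l\<^sup>2 * w / 2" using v0 by simp
  finally have "l * d - l\<^sup>2 * w / 2 \<le> l * d - v * (exp l - 1 - l)" by simp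
  moreover have "l * d - l\<^sup>2 * w / 2 = (- w + d * c + v) / c\<^sup>2"
  proof -
    have dd: "d = (w\<^sup>2 - v\<^sup>2) / (2 * c * v)" using w2 c v0 by (simp add: field_simps)
    show ?thesis unfolding dd l_def using w0 c v0
      by (simp add: field_simps power2_eq_square)
  qed
  ultimately show ?thesis using l0 unfolding w_def by auto
qed

text \<open>Makes \<open>zeta_param\<close> an admissible scale \<open>c\<close> in
  \<open>sub_gamma_exponent\<close>. The case split on \<open>k\<close> covers \<open>k = 0\<close>,
  where \<open>k - 1\<close> is negative but the product under the root is zero.\<close>

lemma zeta_param_ge: "k < n \<Longrightarrow> zeta_param n k \<ge> 4 / 3"
  by (cases k) (auto simp: zeta_param_def intro!: divide_nonneg_nonneg mult_nonneg_nonneg)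

text \<open>Stated for an arbitrary \<open>S\<close>, so that it serves the predicate and its
  negation alike.\<close>

lemma card_upper_tail_le:
  assumes T: "finite T" "card T = n" and S: "S \<subseteq> T" "real (card S) = p * real n"
    and k: "0 < k" "k < n" and d: "d \<ge> 0"
  shows "real (card {A \<in> k_subsets T k. real k * d \<le> real (card (A \<inter> S)) - real k * p}) \<le>
    real (n choose k) * tail_bound n k p d"
proof -
  define \<rho> where "\<rho> = rho_param n k"
  define \<zeta> where "\<zeta> = zeta_param n k"
  define v where "v = p * (1 - p) * \<rho>"
  define N where "N = real (card {A \<in> k_subsets T k. real k * d \<le> real (card (A \<inter> S)) - real k * p})"
  have \<rho>: "\<rho> > 0" unfolding \<rho>_def using k by (rule rho_param_pos)
  have S': "real (card S) = p * real (card T)" using S T by simp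
  have chernoff: "N \<le> real (n choose k) * exp (e - l * (real k * d))"
    if l: "l \<ge> 0" and mgf: "(\<Sum>A\<in>k_subsets T k. exp (l * (real (card (A \<inter> S)) - real k * p))) \<le>
      real (card T choose k) * exp e" for l e
  proof -
    have "N \<le> exp (- (l * (real k * d))) *
        (\<Sum>A\<in>k_subsets T k. exp (l * (real (card (A \<inter> S)) - real k * p)))"
      unfolding N_def by (rule card_ge_le_sum_exp[OF finite_k_subsets[OF T(1)] l])
    also have "\<dots> \<le> exp (- (l * (real k * d))) * (real (n choose k) * exp e)"
      using mgf T by (intro mult_left_mono) auto
    finally show ?thesis by (simp add: exp_diff exp_minus field_simps)
  qed
  have hoeffding: "N \<le> real (n choose k) * exp (- (2 * real k * d\<^sup>2) / \<rho>)"
  proof -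
    \<comment> \<open>The minimiser of the Chernoff exponent
      \<open>l^2 * k * \<rho> / 8 - l * k * d\<close>.\<close>
    define l where "l = 4 * d / \<rho>"
    have l: "l \<ge> 0" using d \<rho> by (simp add: l_def)
    have "N \<le> real (n choose k) * exp (l\<^sup>2 * (real k * \<rho>) / 8 - l * (real k * d))"
      using rho_mgf[OF T(1) S(1) S' k(1) _ l] k T unfolding \<rho>_def by (intro chernoff[OF l]) auto
    also have "l\<^sup>2 * (real k * \<rho>) / 8 - l * (real k * d) = - (2 * real k * d\<^sup>2) / \<rho>"
      using \<rho> by (simp add: l_def field_simps power2_eq_square)
    finally show ?thesis .
  qed
  have bernstein: "N \<le> real (n choose k) * (2 * exp (- (real k / \<zeta>\<^sup>2) *
      (- sqrt (2 * \<zeta> * v * d + v\<^sup>2) + d * \<zeta> + v)))"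
  proof -
    have "card S \<le> n" using card_mono[OF T(1) S(1)] T by simp
    hence "p * real n \<le> 1 * real n" "0 \<le> p * real n" unfolding S(2)[symmetric] by auto
    hence "p \<le> 1" "0 \<le> p" using k by (auto simp: zero_le_mult_iff)
    hence v: "v \<ge> 0" using \<rho> by (simp add: v_def)
    have "\<zeta> \<ge> 1" using zeta_param_ge[OF k(2)] by (simp add: \<zeta>_def)
    then obtain l where l: "l \<ge> 0"
      "(- sqrt (2 * \<zeta> * v * d + v\<^sup>2) + d * \<zeta> + v) / \<zeta>\<^sup>2 \<le> l * d - v * (exp l - 1 - l)"
      using sub_gamma_exponent[OF v _ d, of \<zeta>] by blast
    have "N \<le> real (n choose k) * exp (real k * v * (exp l - 1 - l) - l * (real k * d))"
      using rho_bennett_mgf[OF T(1) S(1) S' k(1) _ l(1)] k T unfolding \<rho>_def v_def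
      by (intro chernoff[OF l(1)]) auto
    also have "\<dots> = real (n choose k) * exp (- (real k * (l * d - v * (exp l - 1 - l))))"
      by (simp add: algebra_simps)
    also have "\<dots> \<le> real (n choose k) * exp (- (real k *
        ((- sqrt (2 * \<zeta> * v * d + v\<^sup>2) + d * \<zeta> + v) / \<zeta>\<^sup>2)))"
      using mult_left_mono[OF l(2), of "real k"] by (intro mult_left_mono) auto
    \<comment> \<open>Relaxes the prefactor 1 to the 2 of \<open>tail_bound\<close>.\<close>
    also have "\<dots> \<le> real (n choose k) * (2 * exp (- (real k *
        ((- sqrt (2 * \<zeta> * v * d + v\<^sup>2) + d * \<zeta> + v) / \<zeta>\<^sup>2))))"
      by (intro mult_left_mono) auto
    finally show ?thesis by simp
  qed
  have "tail_bound n k p d = min (2 * exp (- (real k / \<zeta>\<^sup>2) *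
      (- sqrt (2 * \<zeta> * v * d + v\<^sup>2) + d * \<zeta> + v))) (exp (- (2 * real k * d\<^sup>2) / \<rho>))"
    by (simp add: tail_bound_def Let_def \<rho>_def \<zeta>_def v_def power_mult_distrib mult_ac)
  thus ?thesis using hoeffding bernstein unfolding N_def by (simp add: min_def)
qed

section \<open>From the Q-error to two upper tails\<close>

theorem theorem2:
  fixes T :: "'a set" and P :: "'a \<Rightarrow> bool" and n k :: nat and p q :: real
  assumes "finite T" and "card T = n" and "n \<ge> 2"
    and "card {x \<in> T. P x} = p * real n"
    and "0 < p" and "p \<le> 1"
    and "1 \<le> k" and "k < n"
    and "1 \<le> q"
  shows "measure_pmf.prob (sample_wo_repl T k)
           {A. qerror (real n / real k * real (card {x \<in> A. P x})) (p * real n) \<le> q}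
         \<ge> 1 - Omega_bound n k p q - Psi_bound n k p q"
proof -
  define S where "S = {x \<in> T. P x}"
  define M where "M = sample_wo_repl T k"
  define G where "G = {A. qerror (real n / real k * real (card {x \<in> A. P x})) (p * real n) \<le> q}"
  define U where "U = {A \<in> k_subsets T k. real k * (p * q - p) \<le> real (card (A \<inter> S)) - real k * p}"
  \<comment> \<open>A deficit of rows in \<open>S\<close> is written as an excess of rows in
    \<open>T - S\<close>.\<close>
  define L where "L = {A \<in> k_subsets T k.
    real k * (p - p / q) \<le> real (card (A \<inter> (T - S))) - real k * (1 - p)}"
  have S: "S \<subseteq> T" "real (card S) = p * real n" using assms(4) by (auto simp: S_def)
  have S': "real (card (T - S)) = (1 - p) * real n"
    using S assms(1,2) finite_subset[OF S(1)] card_mono[OF assms(1) S(1)]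
    by (simp add: card_Diff_subset of_nat_diff algebra_simps)
  have fin: "finite (k_subsets T k)" using assms(1) by (rule finite_k_subsets)
  have cardk: "card (k_subsets T k) = n choose k" using n_subsets[OF assms(1)] assms(2) by simp
  have ch: "real (n choose k) > 0" using assms(8) by simp
  hence ne: "k_subsets T k \<noteq> {}" using cardk by (metis card.empty of_nat_0 less_irrefl)
  have prob: "measure_pmf.prob M X = real (card (k_subsets T k \<inter> X)) / real (n choose k)" for X
    unfolding M_def sample_wo_repl_def by (simp only: measure_pmf_of_set[OF ne fin] cardk)
  have U: "real (card U) \<le> real (n choose k) * Omega_bound n k p q"
    unfolding U_def Omega_bound_def using assms S by (intro card_upper_tail_le) auto
  have "p / q \<le> p" using assms by (simp add: field_simps)
  hence "real (card L) \<le> real (n choose k) * tail_bound n k (1 - p) (p - p / q)"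
    unfolding L_def using assms S' by (intro card_upper_tail_le) auto
  \<comment> \<open>\<open>tail_bound\<close> depends on \<open>p\<close> only through
    \<open>p * (1 - p)\<close>, which is symmetric under negation of the predicate.\<close>
  also have "tail_bound n k (1 - p) (p - p / q) = Psi_bound n k p q"
  proof -
    have "(1 - p) * (1 - (1 - p)) = p * (1 - p)" by simp
    thus ?thesis by (simp only: tail_bound_def Psi_bound_def)
  qed
  finally have L: "real (card L) \<le> real (n choose k) * Psi_bound n k p q" .
  have bad: "k_subsets T k \<inter> - G \<subseteq> U \<union> L"
  proof
    fix A assume A: "A \<in> k_subsets T k \<inter> - G"
    define X where "X = real (card (A \<inter> S))"
    define est where "est = real n / real k * X"
    have fA: "finite A" using A assms(1) finite_subset by blast
    have AS: "{x \<in> A. P x} = A \<inter> S" using A by (auto simp: S_def)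
    have "card A = card (A \<inter> S) + card (A \<inter> (T - S))"
      using A fA by (subst card_Un_disjoint[symmetric]) (auto intro!: arg_cong[where f = card])
    hence XS: "real (card (A \<inter> (T - S))) = real k - X" using A by (simp add: X_def)
    have "p * real n > 0" using assms by simp
    \<comment> \<open>A positive cardinality is at least 1, so the clamping of the true value has no
      effect.\<close>
    hence "card S \<ge> 1" unfolding S(2)[symmetric] by simp
    hence tru: "p * real n \<ge> 1" unfolding S(2)[symmetric] by simp
    consider "q < max est 1 / (p * real n)" | "q < p * real n / max est 1"
      using A tru by (auto simp: G_def qerror_def AS est_def X_def less_max_iff_disj)
    thus "A \<in> U \<union> L"
    proof cases
      case 1
      hence "q * (p * real n) < max est 1" using tru by (simp add: field_simps)
      \<comment> \<open>Since \<open>max est 1\<close> exceeds a number that is at least 1, the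
        maximum must be \<open>est\<close> itself.\<close>
      moreover have "1 \<le> q * (p * real n)" using mult_mono[OF assms(9) tru] assms by simp
      ultimately have "q * (p * real n) < real n / real k * X" by (simp add: est_def max_def split: if_splits)
      hence "real n * (real k * (p * q)) < real n * X" using assms by (simp add: field_simps)
      hence "real k * (p * q) < X" using assms by simp
      thus ?thesis using A by (simp add: U_def X_def algebra_simps)
    next
      case 2
      hence "q * max est 1 < p * real n" by (simp add: field_simps)
      \<comment> \<open>For under-estimation the clamping only raises the estimate, so the strict
        inequality passes to \<open>est\<close>.\<close>
      moreover have "q * est \<le> q * max est 1" using assms by (intro mult_left_mono) auto
      ultimately have "q * (real n / real k * X) < p * real n" by (simp add: est_def)
      hence "real n * (q * X) < real n * (p * real k)" using assms by (simp add: field_simps)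
      hence "q * X < p * real k" using assms by simp
      hence "X < real k * p / q" using assms by (simp add: field_simps)
      thus ?thesis using A by (simp add: L_def XS algebra_simps)
    qed
  qed
  have "real (n choose k) = real (card (k_subsets T k \<inter> G)) + real (card (k_subsets T k \<inter> - G))"
    using card_Int_Diff[OF fin, of G] unfolding cardk[symmetric] Diff_eq by simp
  moreover have "real (card (k_subsets T k \<inter> - G)) \<le> real (card U) + real (card L)"
  proof -
    have "finite (U \<union> L)" by (rule finite_subset[OF _ fin]) (auto simp: U_def L_def)
    hence "card (k_subsets T k \<inter> - G) \<le> card (U \<union> L)" using bad by (rule card_mono)
    also have "\<dots> \<le> card U + card L" by (rule card_Un_le)
    finally show ?thesis by simp
  qed
  ultimately have "(1 - Omega_bound n k p q - Psi_bound n k p q) * real (n choose k) \<le>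
      real (card (k_subsets T k \<inter> G))"
    using U L by (simp add: algebra_simps)
  thus ?thesis using ch unfolding G_def[symmetric] M_def[symmetric] prob
    by (simp add: field_simps)
qed

end
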